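(* Let $A$ be an $n\times n$ matrix in normal form over $S$, where $S$ is $\mathbb{T}$ or $R$. Then $A^{\nabla}=A^{*}$, where equality is equality of matrices if $S=\mathbb{T}$ and is interpreted as entrywise $\nu$-equivalence $\cong_\nu$ if $S=R$.
   Context: Let $\mathcal{G}$ be a totally ordered abelian group, e.g. $(\mathbb{R},+)$ or $(\mathbb{Q},+)$. The tropical semifield is $\mathbb{T}=\mathcal{G}\cup\{-\infty\}$ with addition $\max$ and multiplication the group operation; its zero is $-\infty$ and its one $1_{\mathbb{T}}$ is the identity of $\mathcal{G}$. The supertropical semiring is $R=\mathcal{G}\cup\mathcal{G}^{\nu}\cup\{-\infty\}$, where $\mathcal{G}$ is the set of tangible elements and $\mathcal{G}^{\nu}=\{a^{\nu}:a\in\mathcal{G}\}$ is a disjoint ordered copy of $\mathcal{G}$ (the ghost elements). Put $(a^{\nu})^{\nu}=a^{\nu}$ and $(-\infty)^\nu=-\infty$; elements are compared through their $\nu$-values $a^\nu$, and $a\cong_\nu b$ means $a^\nu=b^\nu$. Addition: $a+b$ is the one of larger $\nu$-value if $a^{\nu}\ne b^{\nu}$, and $a+b=a^{\nu}$ if $a^{\nu}=b^{\nu}$. Multiplication is the group operation on the underlying elements of $\mathcal{G}$, the product being ghost if at least one factor is ghost; $-\infty$ is additively neutral and multiplicatively absorbing. $0_R=-\infty$, and $1_R$ is the (tangible) identity of $\mathcal{G}$. For $A=(a_{i,j})\in M_n(S)$, $\det(A)=\sum_{\sigma\in S_n}a_{1,\sigma(1)}\cdots a_{n,\sigma(n)}$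 (the permanent). The adjoint $\mathrm{adj}(A)$ has $(i,j)$ entry $\det(A_{j,i})$, where $A_{j,i}$ is $A$ with row $j$ and column $i$ deleted (the empty determinant is $1_S$). When $\det(A)$ is invertible (in $\mathcal{G}$), $A^{\nabla}=\det(A)^{-1}\mathrm{adj}(A)$. A matrix over $S$ is in normal form if all its diagonal entries are $1_S$ and its determinant is $1_S$. The closure is $A^{*}=\sum_{i\ge 0}A^{i}$ with $A^0=I$; the infinite sum is the entrywise supremum of the matrices $A^i$ (over $R$, the supremum of $\nu$-values, the result being considered up to $\cong_\nu$). The claim includes that this supremum exists. *)

theory Defs
  imports "Jordan_Normal_Form.Determinant" "HOL-Library.Lub_Glb"
begin

(* Totally ordered abelian groups are written additively (class linordered_ab_group_add), so
   multiplication in the two semirings below is addition of the underlying group elements, and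
   their unit is the group element 0. *)

datatype 'g tropical = NegInf | Fin 'g

instantiation tropical :: (linorder) linorder
begin

fun less_eq_tropical :: "'a tropical \<Rightarrow> 'a tropical \<Rightarrow> bool" where
  "NegInf \<le> y \<longleftrightarrow> True"
| "Fin a \<le> NegInf \<longleftrightarrow> False"
| "Fin a \<le> Fin b \<longleftrightarrow> a \<le> b"

definition less_tropical :: "'a tropical \<Rightarrow> 'a tropical \<Rightarrow> bool" where
  "less_tropical x y \<longleftrightarrow> x \<le> y \<and> \<not> y \<le> x"

instance
proof
  fix x y z :: "'a tropical"
  show "x < y \<longleftrightarrow> x \<le> y \<and> \<not> y \<le> x" by (simp add: less_tropical_def)
  show "x \<le> x" by (cases x) auto
  show "x \<le> y \<Longrightarrow> y \<le> z \<Longrightarrow> x \<le> z" by (cases x; cases y; cases z) auto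
  show "x \<le> y \<Longrightarrow> y \<le> x \<Longrightarrow> x = y" by (cases x; cases y) auto
  show "x \<le> y \<or> y \<le> x" by (cases x; cases y) auto
qed

end

instantiation tropical :: (linordered_ab_group_add) comm_semiring_1
begin

definition zero_tropical :: "'a tropical" where "0 = NegInf"

definition one_tropical :: "'a tropical" where "1 = Fin 0"

definition plus_tropical :: "'a tropical \<Rightarrow> 'a tropical \<Rightarrow> 'a tropical" where
  "plus_tropical x y = max x y"

fun times_tropical :: "'a tropical \<Rightarrow> 'a tropical \<Rightarrow> 'a tropical" where
  "Fin a * Fin b = Fin (a + b)"
| "NegInf * y = NegInf"
| "x * NegInf = NegInf"

instance
proof
  fix a b c :: "'a tropical"
  show "a * b * c = a * (b * c)" by (cases a; cases b; cases c) (auto simp: add.assoc)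
  show "a * b = b * a" by (cases a; cases b) (auto simp: add.commute)
  show "1 * a = a" by (cases a) (auto simp: one_tropical_def)
  show "a + b + c = a + (b + c)" by (simp add: plus_tropical_def max.assoc)
  show "a + b = b + a" by (simp add: plus_tropical_def max.commute)
  show "0 + a = a" by (simp add: plus_tropical_def zero_tropical_def max_absorb2)
  have mono: "a * c \<le> b * c" if "a \<le> b" for a b :: "'a tropical"
    using that by (cases a; cases b; cases c) simp_all
  then show "(a + b) * c = a * c + b * c"
    using mono[of a b] mono[of b a]
    by (cases "a \<le> b") (simp_all add: plus_tropical_def max_absorb1 max_absorb2)
  show "0 * a = 0" by (simp add: zero_tropical_def)
  show "a * 0 = 0" by (cases a) (auto simp: zero_tropical_def)
  show "(0 :: 'a tropical) \<noteq> 1" by (simp add: zero_tropical_def one_tropical_def)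
qed

end

datatype 'g supertropical = SNegInf | Tangible 'g | Ghost 'g

fun ghost_map :: "'g supertropical \<Rightarrow> 'g supertropical" where
  "ghost_map SNegInf = SNegInf"
| "ghost_map (Tangible a) = Ghost a"
| "ghost_map (Ghost a) = Ghost a"

definition nu_equiv :: "'g supertropical \<Rightarrow> 'g supertropical \<Rightarrow> bool" (infix "\<cong>\<^sub>\<nu>" 50) where
  "x \<cong>\<^sub>\<nu> y \<longleftrightarrow> ghost_map x = ghost_map y"

(* The nu-value, with the ordered set of ghosts together with -infinity identified with 'g tropical. *)
fun nu_val :: "'g supertropical \<Rightarrow> 'g tropical" where
  "nu_val SNegInf = NegInf"
| "nu_val (Tangible a) = Fin a"
| "nu_val (Ghost a) = Fin a"

lemma nu_equiv_iff_nu_val: "x \<cong>\<^sub>\<nu> y \<longleftrightarrow> nu_val x = nu_val y"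
  unfolding nu_equiv_def by (cases x; cases y) auto

(* Comparison of nu-values: only a (total) preorder, since Tangible a and Ghost a are equivalent. *)
instantiation supertropical :: (linorder) preorder
begin

definition less_eq_supertropical :: "'a supertropical \<Rightarrow> 'a supertropical \<Rightarrow> bool" where
  "x \<le> y \<longleftrightarrow> nu_val x \<le> nu_val y"

definition less_supertropical :: "'a supertropical \<Rightarrow> 'a supertropical \<Rightarrow> bool" where
  "x < y \<longleftrightarrow> nu_val x < nu_val y"

instance
  by standard (auto simp: less_eq_supertropical_def less_supertropical_def)

end

instantiation supertropical :: (linordered_ab_group_add) comm_semiring_1
begin

definition zero_supertropical :: "'a supertropical" where "0 = SNegInf"

definition one_supertropical :: "'a supertropical" where "1 = Tangible 0"

definition plus_supertropical :: "'a supertropical \<Rightarrow> 'a supertropical \<Rightarrow> 'a supertropical" where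
  "x + y = (if x \<cong>\<^sub>\<nu> y then ghost_map x else if x < y then y else x)"

fun times_supertropical :: "'a supertropical \<Rightarrow> 'a supertropical \<Rightarrow> 'a supertropical" where
  "Tangible a * Tangible b = Tangible (a + b)"
| "Tangible a * Ghost b = Ghost (a + b)"
| "Ghost a * Tangible b = Ghost (a + b)"
| "Ghost a * Ghost b = Ghost (a + b)"
| "SNegInf * y = SNegInf"
| "x * SNegInf = SNegInf"

lemma plus_supertropical_cases:
  fixes x y :: "'a supertropical"
  shows "nu_val x < nu_val y \<Longrightarrow> x + y = y"
    and "nu_val y < nu_val x \<Longrightarrow> x + y = x"
    and "nu_val x = nu_val y \<Longrightarrow> x + y = ghost_map x"
  by (auto simp: plus_supertropical_def nu_equiv_iff_nu_val less_supertropical_def)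

lemma nu_val_ghost_map: "nu_val (ghost_map x) = nu_val x"
  by (cases x) auto

lemma ghost_map_eq: "nu_val x = nu_val y \<Longrightarrow> ghost_map x = ghost_map y"
  using nu_equiv_iff_nu_val nu_equiv_def by metis

lemma ghost_map_idem: "ghost_map (ghost_map x) = ghost_map x"
  by (cases x) auto

lemma ghost_map_mult: "ghost_map (x * y) = ghost_map x * (y :: 'a supertropical)"
  by (cases x; cases y) auto

lemma nu_val_mult_less:
  "nu_val x < nu_val y \<Longrightarrow> z \<noteq> SNegInf \<Longrightarrow> nu_val (x * z) < nu_val (y * (z :: 'a supertropical))"
  by (cases x; cases y; cases z) (auto simp: less_le)

lemma nu_val_mult_eq:
  "nu_val x = nu_val y \<Longrightarrow> nu_val (x * z) = nu_val (y * (z :: 'a supertropical))"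
  by (cases x; cases y; cases z) auto

lemma plus_supertropical_assoc:
  fixes a b c :: "'a supertropical"
  shows "a + b + c = a + (b + c)"
proof -
  note simps = plus_supertropical_cases nu_val_ghost_map ghost_map_idem
  consider "nu_val a < nu_val b" | "nu_val b < nu_val a" | "nu_val a = nu_val b" by fastforce
  then show ?thesis
  proof cases
    case 1
    then consider "nu_val b < nu_val c" "nu_val a < nu_val c"
      | "nu_val c < nu_val b" | "nu_val b = nu_val c" by fastforce
    then show ?thesis using 1 by cases (simp_all add: simps)
  next
    case 2
    consider "nu_val b < nu_val c" | "nu_val c < nu_val b" "nu_val c < nu_val a"
      | "nu_val b = nu_val c" using 2 by fastforce
    then show ?thesis using 2 by cases (simp_all add: simps)
  next
    case 3
    consider "nu_val b < nu_val c" | "nu_val c < nu_val b" | "nu_val b = nu_val c" by fastforce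
    then show ?thesis using 3 ghost_map_eq[OF 3] by cases (simp_all add: simps)
  qed
qed

lemma plus_supertropical_distrib:
  fixes a b c :: "'a supertropical"
  shows "(a + b) * c = a * c + b * c"
proof (cases "c = SNegInf")
  case True
  have "x * SNegInf = SNegInf" for x :: "'a supertropical" by (cases x) auto
  then show ?thesis using True by (simp add: plus_supertropical_def)
next
  case False
  consider "nu_val a < nu_val b" | "nu_val b < nu_val a" | "nu_val a = nu_val b" by fastforce
  then show ?thesis
    using False nu_val_mult_less[of a b c] nu_val_mult_less[of b a c] nu_val_mult_eq[of a b c]
    by cases (simp_all add: plus_supertropical_cases ghost_map_mult)
qed

instance
proof
  fix a b c :: "'a supertropical"
  show "a * b * c = a * (b * c)" by (cases a; cases b; cases c) (auto simp: add.assoc)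
  show "a * b = b * a" by (cases a; cases b) (auto simp: add.commute)
  show "1 * a = a" by (cases a) (auto simp: one_supertropical_def)
  show "a + b + c = a + (b + c)" by (rule plus_supertropical_assoc)
  show "a + b = b + a"
    using linorder_less_linear[of "nu_val a" "nu_val b"] ghost_map_eq[of a b]
    by (auto simp: plus_supertropical_cases)
  show "0 + a = a"
    by (cases a) (auto simp: plus_supertropical_def nu_equiv_def less_supertropical_def
        less_tropical_def zero_supertropical_def)
  show "(a + b) * c = a * c + b * c" by (rule plus_supertropical_distrib)
  show "0 * a = 0" by (simp add: zero_supertropical_def)
  show "a * 0 = 0" by (cases a) (auto simp: zero_supertropical_def)
  show "(0 :: 'a supertropical) \<noteq> 1" by (simp add: zero_supertropical_def one_supertropical_def)
qed

end

(* The sign-free determinant; the library's det carries signs and needs a commutative ring. *)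
definition perm_det :: "'a::comm_semiring_1 mat \<Rightarrow> 'a" where
  "perm_det A = (\<Sum>p | p permutes {0..<dim_row A}. \<Prod>i = 0..<dim_row A. A $$ (i, p i))"

definition perm_adj :: "'a::comm_semiring_1 mat \<Rightarrow> 'a mat" where
  "perm_adj A = mat (dim_row A) (dim_col A) (\<lambda>(i, j). perm_det (mat_delete A j i))"

(* Only meaningful when x is invertible; the inverse is then unique. *)
definition unit_inv :: "'a::comm_semiring_1 \<Rightarrow> 'a" where
  "unit_inv x = (THE y. x * y = 1)"

lemma unit_inv_Fin: "unit_inv (Fin a) = Fin (- a :: 'g::linordered_ab_group_add)"
  unfolding unit_inv_def
proof (rule the_equality)
  show "Fin a * Fin (- a) = 1" by (simp add: one_tropical_def)
  fix y assume "Fin a * y = 1"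
  then show "y = Fin (- a)" by (cases y) (auto simp: one_tropical_def add_eq_0_iff)
qed

lemma unit_inv_Tangible:
  "unit_inv (Tangible a) = Tangible (- a :: 'g::linordered_ab_group_add)"
  unfolding unit_inv_def
proof (rule the_equality)
  show "Tangible a * Tangible (- a) = 1" by (simp add: one_supertropical_def)
  fix y assume "Tangible a * y = 1"
  then show "y = Tangible (- a)" by (cases y) (auto simp: one_supertropical_def add_eq_0_iff)
qed

definition nabla :: "'a::comm_semiring_1 mat \<Rightarrow> 'a mat" where
  "nabla A = unit_inv (perm_det A) \<cdot>\<^sub>m perm_adj A"

definition normal_form :: "nat \<Rightarrow> 'a::comm_semiring_1 mat \<Rightarrow> bool" where
  "normal_form n A \<longleftrightarrow>
     A \<in> carrier_mat n n \<and> (\<forall>i<n. A $$ (i, i) = 1) \<and> perm_det A = 1"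

(* C is the entrywise supremum of the powers of A. Neither semiring is order-complete, so the
   closure is a relation and its existence is a separate assertion. Over 'g tropical there is at most
   one closure; over 'g supertropical, where the order is the preorder of nu-values, the least
   upper bounds are determined exactly up to nu-equivalence. *)
definition is_closure ::
  "nat \<Rightarrow> 'a::{comm_semiring_1, preorder} mat \<Rightarrow> 'a mat \<Rightarrow> bool" where
  "is_closure n A C \<longleftrightarrow> C \<in> carrier_mat n n \<and>
     (\<forall>i<n. \<forall>j<n. isLub UNIV (range (\<lambda>k. (A ^\<^sub>m k) $$ (i, j))) (C $$ (i, j)))"

definition mat_nu_equiv ::
  "'g supertropical mat \<Rightarrow> 'g supertropical mat \<Rightarrow> bool" where
  "mat_nu_equiv A B \<longleftrightarrow> dim_row A = dim_row B \<and> dim_col A = dim_col B \<and>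
     (\<forall>i<dim_row A. \<forall>j<dim_col A. A $$ (i, j) \<cong>\<^sub>\<nu> B $$ (i, j))"

lemma is_closure_tropical_unique:
  fixes A :: "'g::linordered_ab_group_add tropical mat"
  assumes C: "is_closure n A C" and D: "is_closure n A D"
  shows "C = D"
proof (rule eq_matI)
  fix i j assume "i < dim_row D" "j < dim_col D"
  then have "i < n" "j < n" using D unfolding is_closure_def by auto
  then have "isLub UNIV (range (\<lambda>k. (A ^\<^sub>m k) $$ (i, j))) (C $$ (i, j))"
    "isLub UNIV (range (\<lambda>k. (A ^\<^sub>m k) $$ (i, j))) (D $$ (i, j))"
    using C D unfolding is_closure_def by blast+
  then show "C $$ (i, j) = D $$ (i, j)" by (rule isLub_unique)
qed (use C D in \<open>auto simp: is_closure_def\<close>)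

lemma is_closure_supertropical_unique:
  fixes A :: "'g::linordered_ab_group_add supertropical mat"
  assumes C: "is_closure n A C" and D: "D \<in> carrier_mat n n"
  shows "is_closure n A D \<longleftrightarrow> mat_nu_equiv C D"
proof -
  have lub_iff: "isLub UNIV S x \<longleftrightarrow> (\<forall>s\<in>S. s \<le> x) \<and> (\<forall>u. (\<forall>s\<in>S. s \<le> u) \<longrightarrow> x \<le> u)"
    for S and x :: "'g supertropical"
    by (simp add: isLub_def leastP_def isUb_def setle_def setge_def)
  have equiv_iff: "x \<cong>\<^sub>\<nu> y \<longleftrightarrow> x \<le> y \<and> y \<le> x" for x y :: "'g supertropical"
    unfolding nu_equiv_iff_nu_val less_eq_supertropical_def by (rule order_eq_iff)
  have lub: "isLub UNIV S y \<longleftrightarrow> x \<cong>\<^sub>\<nu> y" if x: "isLub UNIV S x"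
    for S and x y :: "'g supertropical"
  proof
    assume "isLub UNIV S y"
    then show "x \<cong>\<^sub>\<nu> y" using x unfolding lub_iff equiv_iff by blast
  next
    assume "x \<cong>\<^sub>\<nu> y"
    then have xy: "x \<le> y" "y \<le> x" unfolding equiv_iff by auto
    show "isLub UNIV S y"
      using x unfolding lub_iff by (auto intro: order_trans[OF _ xy(1)] order_trans[OF xy(2)])
  qed
  have entry: "isLub UNIV (range (\<lambda>k. (A ^\<^sub>m k) $$ (i, j))) (D $$ (i, j))
      \<longleftrightarrow> C $$ (i, j) \<cong>\<^sub>\<nu> D $$ (i, j)" if "i < n" "j < n" for i j
    using C that unfolding is_closure_def by (intro lub) blast
  have dims: "dim_row C = n" "dim_col C = n" "dim_row D = n" "dim_col D = n"
    using C D unfolding is_closure_def by auto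
  show ?thesis
    unfolding is_closure_def mat_nu_equiv_def dims using D entry by blast
qed

end

theory Submission
  imports Defs
begin

text \<open>Since the determinant and the diagonal entries are \<open>1\<close>, every permutation weight, and hence
  every cycle weight, is at most \<open>1\<close>. The entry \<open>(i, j)\<close> of the adjoint is the largest weight of a
  permutation \<open>\<sigma>\<close> with \<open>\<sigma> j = i\<close> from which the edge \<open>j \<rightarrow> i\<close> has been removed, that is, of a path
  from \<open>i\<close> to \<open>j\<close> together with disjoint cycles. Dropping the cycles bounds it by an entry of a
  power of \<open>A\<close>. Conversely, \<open>I \<le> adj A\<close> and \<open>A * adj A \<le> adj A\<close>, because an edge \<open>i \<rightarrow> l\<close> put in
  front of a path from \<open>l\<close> to \<open>j\<close> leaves a path from \<open>i\<close> to \<open>j\<close> after a cycle through \<open>i\<close> is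
  replaced by loops; so all powers of \<open>A\<close> are below the adjoint. The supertropical case follows by
  applying the semiring homomorphism \<open>nu_val\<close>.\<close>

subsection \<open>The adjoint as a sum over permutations\<close>

lemma unit_inv_one: "unit_inv (1 :: 'a::comm_semiring_1) = 1"
  unfolding unit_inv_def by simp

lemma nabla_normal_form:
  assumes "normal_form n A"
  shows "nabla A = perm_adj A"
  using assms by (intro eq_matI) (auto simp: nabla_def normal_form_def unit_inv_one)

lemma perm_adj_carrier [simp]: "A \<in> carrier_mat n n \<Longrightarrow> perm_adj A \<in> carrier_mat n n"
  unfolding perm_adj_def by auto

text \<open>\<open>permutation_insert j i\<close> matches the permutations of the deleted matrix
  with those sending \<open>j\<close> to \<open>i\<close>. Rows and columns keep their original
  numbers, so paths and cycles can be read off.\<close>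

lemma perm_adj_index:
  fixes A :: "'a::comm_semiring_1 mat"
  assumes A: "A \<in> carrier_mat n n" and i: "i < n" and j: "j < n"
  shows "perm_adj A $$ (i, j) =
    (\<Sum>\<sigma> | \<sigma> permutes {0..<n} \<and> \<sigma> j = i. \<Prod>r\<in>{0..<n} - {j}. A $$ (r, \<sigma> r))"
proof -
  obtain m where m: "n = Suc m" using i by (cases n) auto
  have i': "i < Suc m" and j': "j < Suc m" using i j m by auto
  have weight: "(\<Prod>r\<in>{0..<n} - {j}. A $$ (r, permutation_insert j i q r)) =
      (\<Prod>r = 0..<m. mat_delete A j i $$ (r, q r))" if q: "q permutes {0..<m}" for q
  proof -
    \<comment> \<open>\<open>insert_index j\<close> runs through the rows other than
      \<open>j\<close>.\<close>
    have "(\<Prod>r\<in>{0..<n} - {j}. A $$ (r, permutation_insert j i q r)) =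
        (\<Prod>r = 0..<m. A $$ (insert_index j r, permutation_insert j i q (insert_index j r)))"
      unfolding m insert_index_image[OF j', symmetric]
      by (simp add: prod.reindex[OF insert_index_inj_on])
    also have "\<dots> = (\<Prod>r = 0..<m. mat_delete A j i $$ (r, q r))"
    proof (rule prod.cong[OF refl])
      fix r assume r: "r \<in> {0..<m}"
      then have "q r < m" using permutes_in_image[OF q, of r] by auto
      then have "mat_delete A j i $$ (r, q r) = A $$ (insert_index j r, insert_index i (q r))"
        using r A m mat_delete_index[of A m j i r "q r"] i' j' by auto
      moreover have "permutation_insert j i q (insert_index j r) = insert_index i (q r)"
        by (auto simp: permutation_insert_expand insert_index_def)
      ultimately show "A $$ (insert_index j r, permutation_insert j i q (insert_index j r)) =
          mat_delete A j i $$ (r, q r)" by simp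
    qed
    finally show ?thesis .
  qed
  have "perm_adj A $$ (i, j) =
      (\<Sum>q | q permutes {0..<m}. \<Prod>r = 0..<m. mat_delete A j i $$ (r, q r))"
    using A i j m by (simp add: perm_adj_def perm_det_def)
  also have "\<dots> = (\<Sum>q | q permutes {0..<m}.
      \<Prod>r\<in>{0..<n} - {j}. A $$ (r, permutation_insert j i q r))"
    by (rule sum.cong) (auto simp: weight)
  also have "\<dots> = (\<Sum>\<sigma>\<in>permutation_insert j i ` {q. q permutes {0..<m}}.
      \<Prod>r\<in>{0..<n} - {j}. A $$ (r, \<sigma> r))"
    by (simp add: sum.reindex[OF permutation_insert_inj_on[OF j' i']])
  also have "permutation_insert j i ` {q. q permutes {0..<m}} =
      {\<sigma>. \<sigma> permutes {0..<n} \<and> \<sigma> j = i}"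
    unfolding m by (rule permutation_fix[OF j' i', symmetric])
  finally show ?thesis .
qed

lemma finite_permutations_sending: "finite {\<sigma>. \<sigma> permutes {0..<n :: nat} \<and> \<sigma> j = i}"
  by (rule finite_subset[OF _ finite_permutations[of "{0..<n}"]]) auto

text \<open>\<open>pow_mat\<close> attaches new factors on the right, while the induction in
  \<open>pow_le_perm_adj\<close> puts an edge in front of a walk.\<close>

lemma pow_mat_Suc_left:
  fixes A :: "'a::semiring_1 mat"
  assumes A: "A \<in> carrier_mat n n"
  shows "A ^\<^sub>m Suc k = A * A ^\<^sub>m k"
proof (induction k)
  case 0
  show ?case using A by simp
next
  case (Suc k)
  have "A ^\<^sub>m Suc (Suc k) = (A * A ^\<^sub>m k) * A" using Suc by simp
  also have "\<dots> = A * (A ^\<^sub>m k * A)"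
    using A by (intro assoc_mult_mat[of _ n n _ n _ n]) auto
  finally show ?case by simp
qed

lemma mult_mat_index:
  assumes "A \<in> carrier_mat n n" "B \<in> carrier_mat n n" "i < n" "j < n"
  shows "(A * B) $$ (i, j) = (\<Sum>l = 0..<n. A $$ (i, l) * B $$ (l, j))"
  using assms by (simp add: scalar_prod_def)

text \<open>Since \<open>\<tau>\<close> is bijective on the invariant set \<open>S\<close>, its
  action there can be kept while all other points become loops.\<close>

lemma permutes_restrict_invariant:
  assumes \<tau>: "\<tau> permutes N" and S: "S \<subseteq> N" and inv: "\<tau> ` S = S"
  shows "(\<lambda>r. if r \<in> S then \<tau> r else r) permutes N"
proof (rule permutes_subset[OF _ S])
  have "bij_betw \<tau> S S"
    using permutes_inj_on[OF \<tau>] inv by (simp add: bij_betw_def)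
  then have "bij_betw (\<lambda>r. if r \<in> S then \<tau> r else r) S S"
    by (subst bij_betw_cong[where g = \<tau>]) auto
  then show "(\<lambda>r. if r \<in> S then \<tau> r else r) permutes S"
    by (rule bij_imp_permutes) auto
qed

lemma permutes_Diff_invariant:
  assumes "\<tau> permutes N" and "\<tau> ` S = S"
  shows "\<tau> ` (N - S) = N - S"
  using assms by (simp add: image_set_diff permutes_inj permutes_image)

subsection \<open>Order properties of the tropical semiring\<close>

lemma tropical_zero_le: "(0 :: 'g::linordered_ab_group_add tropical) \<le> x"
  by (simp add: zero_tropical_def)

lemma tropical_mult_mono:
  fixes a b c d :: "'g::linordered_ab_group_add tropical"
  shows "a \<le> b \<Longrightarrow> c \<le> d \<Longrightarrow> a * c \<le> b * d"
  by (cases a; cases b; cases c; cases d) (auto intro: add_mono)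

text \<open>Addition is \<open>max\<close>, so a finite sum is a maximum; the empty sum is the least
  element.\<close>

lemma tropical_sum_le_iff:
  fixes f :: "'a \<Rightarrow> 'g::linordered_ab_group_add tropical"
  shows "finite S \<Longrightarrow> sum f S \<le> u \<longleftrightarrow> (\<forall>x\<in>S. f x \<le> u)"
  by (induction S rule: finite_induct) (auto simp: tropical_zero_le plus_tropical_def)

lemma tropical_le_sum:
  fixes f :: "'a \<Rightarrow> 'g::linordered_ab_group_add tropical"
  shows "finite S \<Longrightarrow> x \<in> S \<Longrightarrow> f x \<le> sum f S"
  using tropical_sum_le_iff[of S f "sum f S"] by auto

text \<open>The walk is one of the terms whose maximum is the entry of the power.\<close>

lemma tropical_walk_le_pow:
  fixes A :: "'g::linordered_ab_group_add tropical mat"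
  assumes A: "A \<in> carrier_mat n n"
  shows "(\<And>t. t \<le> k \<Longrightarrow> w t < n) \<Longrightarrow>
    (\<Prod>t = 0..<k. A $$ (w t, w (Suc t))) \<le> (A ^\<^sub>m k) $$ (w 0, w k)"
proof (induction k)
  case 0
  then show ?case using A by auto
next
  case (Suc k)
  have "(\<Prod>t = 0..<Suc k. A $$ (w t, w (Suc t))) \<le>
      (A ^\<^sub>m k) $$ (w 0, w k) * A $$ (w k, w (Suc k))"
    using Suc by (auto intro: tropical_mult_mono)
  also have "\<dots> \<le> (\<Sum>l = 0..<n. (A ^\<^sub>m k) $$ (w 0, l) * A $$ (l, w (Suc k)))"
    using Suc.prems[of k] tropical_le_sum[of "{0..<n}" "w k"
        "\<lambda>l. (A ^\<^sub>m k) $$ (w 0, l) * A $$ (l, w (Suc k))"] by simp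
  also have "\<dots> = (A ^\<^sub>m Suc k) $$ (w 0, w (Suc k))"
    unfolding pow_mat.simps using A Suc.prems by (intro mult_mat_index[symmetric]) auto
  finally show ?case .
qed

subsection \<open>The tropical case\<close>

lemma permutation_weight_le_1:
  fixes A :: "'g::linordered_ab_group_add tropical mat"
  assumes "normal_form n A" and "\<sigma> permutes {0..<n}"
  shows "(\<Prod>r = 0..<n. A $$ (r, \<sigma> r)) \<le> 1"
  using assms tropical_le_sum[of "{p. p permutes {0..<n}}" \<sigma> "\<lambda>p. \<Prod>r = 0..<n. A $$ (r, p r)"]
  by (auto simp: normal_form_def perm_det_def finite_permutations)

text \<open>Loops have weight 1, so completing the cycles on \<open>S\<close> by loops gives a
  permutation of all indices with the same weight.\<close>

lemma invariant_weight_le_1: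
  fixes A :: "'g::linordered_ab_group_add tropical mat"
  assumes A: "normal_form n A" and \<tau>: "\<tau> permutes {0..<n}"
    and S: "S \<subseteq> {0..<n}" and inv: "\<tau> ` S = S"
  shows "(\<Prod>r\<in>S. A $$ (r, \<tau> r)) \<le> 1"
proof -
  let ?\<rho> = "\<lambda>r. if r \<in> S then \<tau> r else r"
  have "(\<Prod>r = 0..<n. A $$ (r, ?\<rho> r)) =
      (\<Prod>r\<in>{0..<n} - S. A $$ (r, ?\<rho> r)) * (\<Prod>r\<in>S. A $$ (r, ?\<rho> r))"
    by (rule prod.subset_diff[OF S]) simp
  also have "(\<Prod>r\<in>{0..<n} - S. A $$ (r, ?\<rho> r)) = 1"
    using A by (intro prod.neutral) (auto simp: normal_form_def)
  finally have "(\<Prod>r = 0..<n. A $$ (r, ?\<rho> r)) = (\<Prod>r\<in>S. A $$ (r, \<tau> r))"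
    by simp
  then show ?thesis
    using permutation_weight_le_1[OF A permutes_restrict_invariant[OF \<tau> S inv]] by simp
qed

section \<open>Powers of the matrix lie below the adjoint\<close>

lemma permutation_weight_le_perm_adj:
  fixes A :: "'g::linordered_ab_group_add tropical mat"
  assumes "A \<in> carrier_mat n n" and "\<sigma> permutes {0..<n}" and "j < n"
  shows "(\<Prod>r\<in>{0..<n} - {j}. A $$ (r, \<sigma> r)) \<le> perm_adj A $$ (\<sigma> j, j)"
proof -
  have "\<sigma> j < n" using permutes_in_image[OF assms(2), of j] assms(3) by simp
  then show ?thesis
    using assms tropical_le_sum[OF finite_permutations_sending, of \<sigma> n j "\<sigma> j"
        "\<lambda>\<sigma>. \<Prod>r\<in>{0..<n} - {j}. A $$ (r, \<sigma> r)"]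
    by (simp add: perm_adj_index)
qed

lemma one_le_perm_adj_diag:
  fixes A :: "'g::linordered_ab_group_add tropical mat"
  assumes A: "normal_form n A" and j: "j < n"
  shows "1 \<le> perm_adj A $$ (j, j)"
proof -
  have "(\<Prod>r\<in>{0..<n} - {j}. A $$ (r, id r)) = 1"
    using A by (intro prod.neutral) (auto simp: normal_form_def)
  then show ?thesis
    using permutation_weight_le_perm_adj[of A n id j] A j
    by (simp add: normal_form_def permutes_id)
qed

text \<open>Replacing \<open>\<tau>\<close> by loops on \<open>S\<close> and precomposing with the transposition of \<open>i\<close> and \<open>j\<close> yields
  a permutation sending \<open>j\<close> to \<open>i\<close> and \<open>i\<close> to \<open>\<tau> j\<close>.\<close>

lemma edge_times_weight_le_perm_adj:
  fixes A :: "'g::linordered_ab_group_add tropical mat"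
  assumes A: "normal_form n A" and \<tau>: "\<tau> permutes {0..<n}"
    and S: "S \<subseteq> {0..<n}" and inv: "\<tau> ` S = S" and i: "i \<in> S" and j: "j < n" "j \<notin> S"
  shows "A $$ (i, \<tau> j) * (\<Prod>r\<in>{0..<n} - {j}. A $$ (r, \<tau> r)) \<le> perm_adj A $$ (i, j)"
proof -
  let ?N = "{0..<n}" and ?T = "{0..<n} - S - {j}"
  let ?\<rho>' = "\<lambda>r. if r \<in> ?N - S then \<tau> r else r"
  define \<rho> where "\<rho> = ?\<rho>' \<circ> transpose i j"
  have carr: "A \<in> carrier_mat n n" using A by (simp add: normal_form_def)
  have fin: "finite S" using S finite_subset by blast
  have "?\<rho>' permutes ?N"
    by (rule permutes_restrict_invariant[OF \<tau> _ permutes_Diff_invariant[OF \<tau> inv]]) auto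
  moreover have "transpose i j permutes ?N" using S i j by (intro permutes_swap_id) auto
  ultimately have \<rho>: "\<rho> permutes ?N" unfolding \<rho>_def by (intro permutes_compose)
  have \<rho>j: "\<rho> j = i" using i by (simp add: \<rho>_def)
  have \<rho>i: "\<rho> i = \<tau> j" using j by (simp add: \<rho>_def)
  have \<rho>S: "\<rho> r = r" if "r \<in> S - {i}" for r
    using that j by (auto simp: \<rho>_def transpose_def)
  have \<rho>T: "\<rho> r = \<tau> r" if "r \<in> ?T" for r
    using that i by (auto simp: \<rho>_def transpose_def)
  have split: "?N - {j} = S \<union> ?T" using S j by auto
  have "(\<Prod>r\<in>?N - {j}. A $$ (r, \<tau> r)) = (\<Prod>r\<in>S. A $$ (r, \<tau> r)) * (\<Prod>r\<in>?T. A $$ (r, \<tau> r))"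
    unfolding split using fin by (intro prod.union_disjoint) auto
  also have "\<dots> \<le> 1 * (\<Prod>r\<in>?T. A $$ (r, \<tau> r))"
    by (rule tropical_mult_mono[OF invariant_weight_le_1[OF A \<tau> S inv] order_refl])
  finally have "A $$ (i, \<tau> j) * (\<Prod>r\<in>?N - {j}. A $$ (r, \<tau> r)) \<le>
      A $$ (i, \<tau> j) * (\<Prod>r\<in>?T. A $$ (r, \<tau> r))"
    by (auto intro: tropical_mult_mono)
  also have "(\<Prod>r\<in>?T. A $$ (r, \<tau> r)) = (\<Prod>r\<in>?T. A $$ (r, \<rho> r))"
    by (rule prod.cong) (auto simp: \<rho>T)
  \<comment> \<open>On \<open>S\<close> the permutation \<open>\<rho>\<close> has loops except at
    \<open>i\<close>, where it uses the edge \<open>i \<rightarrow> \<tau> j\<close>.\<close>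
  also have "A $$ (i, \<tau> j) * \<dots> = (\<Prod>r\<in>S. A $$ (r, \<rho> r)) * \<dots>"
  proof -
    have "(\<Prod>r\<in>S - {i}. A $$ (r, \<rho> r)) = 1"
      using A S \<rho>S by (intro prod.neutral) (auto simp: normal_form_def)
    then show ?thesis using prod.remove[OF fin i, of "\<lambda>r. A $$ (r, \<rho> r)"] \<rho>i by simp
  qed
  also have "\<dots> = (\<Prod>r\<in>?N - {j}. A $$ (r, \<rho> r))"
    unfolding split using fin by (intro prod.union_disjoint[symmetric]) auto
  also have "\<dots> \<le> perm_adj A $$ (i, j)"
    using permutation_weight_le_perm_adj[OF carr \<rho> j(1)] \<rho>j by simp
  finally show ?thesis .
qed

lemma finite_invariantI:
  assumes "\<tau> permutes N" and "finite S" and "\<tau> ` S \<subseteq> S"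
  shows "\<tau> ` S = S"
  using assms by (intro endo_inj_surj) (auto intro: permutes_inj_on)

text \<open>The product over \<open>r\<close> describes a path from \<open>\<sigma> j\<close> to
  \<open>j\<close> and disjoint cycles. If \<open>i = j\<close>, the new edge closes the path to a
  cycle. If \<open>i\<close> lies on another cycle, that cycle becomes loops and the edge extends
  the path. If \<open>i\<close> lies on the path, the edge closes its initial part to a cycle,
  leaving a path from \<open>i\<close> to \<open>j\<close>.\<close>

lemma edge_times_perm_adj_le:
  fixes A :: "'g::linordered_ab_group_add tropical mat"
  assumes A: "normal_form n A" and \<sigma>: "\<sigma> permutes {0..<n}" and i: "i < n" and j: "j < n"
  shows "A $$ (i, \<sigma> j) * (\<Prod>r\<in>{0..<n} - {j}. A $$ (r, \<sigma> r)) \<le> perm_adj A $$ (i, j)"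
proof (cases "i = j")
  case True
  have "A $$ (i, \<sigma> j) * (\<Prod>r\<in>{0..<n} - {j}. A $$ (r, \<sigma> r)) = (\<Prod>r = 0..<n. A $$ (r, \<sigma> r))"
    using j True by (subst prod.remove[of "{0..<n}" j]) auto
  also have "\<dots> \<le> 1" by (rule permutation_weight_le_1[OF A \<sigma>])
  also have "\<dots> \<le> perm_adj A $$ (i, j)" using one_le_perm_adj_diag[OF A j] True by simp
  finally show ?thesis .
next
  case ij: False
  let ?N = "{0..<n}"
  have orbit: "(\<sigma> ^^ t) i \<in> ?N" for t
    using permutes_in_funpow_image[OF \<sigma>, of i t] i by simp
  show ?thesis
  proof (cases "\<exists>t. (\<sigma> ^^ t) i = j")
    case False
    let ?S = "range (\<lambda>t. (\<sigma> ^^ t) i)"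
    have S: "?S \<subseteq> ?N" using orbit by auto
    have "\<sigma> ((\<sigma> ^^ t) i) \<in> ?S" for t by (rule range_eqI[of _ _ "Suc t"]) simp
    then have "\<sigma> ` ?S = ?S"
      using finite_subset[OF S] by (intro finite_invariantI[OF \<sigma>]) auto
    moreover have "i \<in> ?S" by (rule range_eqI[of _ _ 0]) simp
    ultimately show ?thesis
      using False by (intro edge_times_weight_le_perm_adj[OF A \<sigma> S _ _ j]) auto
  next
    case True
    define k where "k = (LEAST t. (\<sigma> ^^ t) i = j)"
    have k: "(\<sigma> ^^ k) i = j" unfolding k_def using True by (rule LeastI_ex)
    have least: "(\<sigma> ^^ t) i \<noteq> j" if "t < k" for t
      using not_less_Least[OF that[unfolded k_def]] .
    have "k \<noteq> 0" using k ij by (cases k) auto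
    \<comment> \<open>A return to \<open>i\<close> at time \<open>t\<close> could be cut out,
      reaching \<open>j\<close> already at time \<open>k - t\<close>.\<close>
    have not_i: "(\<sigma> ^^ t) i \<noteq> i" if t: "t \<in> {1..k}" for t
    proof
      assume "(\<sigma> ^^ t) i = i"
      then have "(\<sigma> ^^ (k - t)) i = (\<sigma> ^^ (k - t + t)) i" unfolding funpow_add by simp
      then show False using t k least[of "k - t"] by auto
    qed
    \<comment> \<open>Composition with the transposition splits the common cycle of \<open>i\<close> and \<open>j\<close>.\<close>
    define \<tau> where "\<tau> = \<sigma> \<circ> transpose i j"
    \<comment> \<open>The points after \<open>i\<close> up to \<open>j\<close>. Starting at time 1
      makes the complement an invariant set of \<open>\<tau>\<close> that contains \<open>i\<close>
      but not \<open>j\<close>.\<close>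
    define M where "M = (\<lambda>t. (\<sigma> ^^ t) i) ` {1..k}"
    have \<tau>: "\<tau> permutes ?N"
      unfolding \<tau>_def using i j \<sigma> by (intro permutes_compose permutes_swap_id) auto
    have "\<tau> ((\<sigma> ^^ t) i) \<in> M" if t: "t \<in> {1..k}" for t
    proof (cases "t = k")
      case True
      then have "\<tau> ((\<sigma> ^^ t) i) = (\<sigma> ^^ 1) i" using k by (simp add: \<tau>_def)
      then show ?thesis unfolding M_def using \<open>k \<noteq> 0\<close> by (intro image_eqI[of _ _ 1]) auto
    next
      case False
      then have "\<tau> ((\<sigma> ^^ t) i) = (\<sigma> ^^ Suc t) i"
        using not_i[OF t] least[of t] t by (simp add: \<tau>_def transpose_def)
      then show ?thesis unfolding M_def using False t by (intro image_eqI[of _ _ "Suc t"]) auto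
    qed
    then have "\<tau> ` M = M" by (intro finite_invariantI[OF \<tau>]) (auto simp: M_def)
    then have inv: "\<tau> ` (?N - M) = ?N - M" by (rule permutes_Diff_invariant[OF \<tau>])
    have "j \<in> M" unfolding M_def using k \<open>k \<noteq> 0\<close> by (intro image_eqI[of _ _ k]) auto
    moreover have "i \<notin> M" unfolding M_def using not_i by fastforce
    ultimately have *: "A $$ (i, \<tau> j) * (\<Prod>r\<in>?N - {j}. A $$ (r, \<tau> r)) \<le> perm_adj A $$ (i, j)"
      using i by (intro edge_times_weight_le_perm_adj[OF A \<tau> _ inv _ j]) auto
    have remove: "(\<Prod>r\<in>?N - {j}. A $$ (r, p r)) =
        A $$ (i, p i) * (\<Prod>r\<in>?N - {j} - {i}. A $$ (r, p r))" for p
      using i ij by (intro prod.remove) auto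
    have "(\<Prod>r\<in>?N - {j} - {i}. A $$ (r, \<tau> r)) = (\<Prod>r\<in>?N - {j} - {i}. A $$ (r, \<sigma> r))"
      by (rule prod.cong) (auto simp: \<tau>_def transpose_def)
    \<comment> \<open>Since \<open>\<tau> i = \<sigma> j\<close> and
      \<open>\<tau> j = \<sigma> i\<close>, both products use the same two edges leaving
      \<open>i\<close>, in opposite order.\<close>
    then show ?thesis
      using * unfolding remove by (simp add: \<tau>_def mult.left_commute)
  qed
qed

text \<open>Induction from \<open>I \<le> perm_adj A\<close> by
  \<open>A * perm_adj A \<le> perm_adj A\<close>; the new edge changes the starting point, so
  \<open>i\<close> is generalized.\<close>

lemma pow_le_perm_adj:
  fixes A :: "'g::linordered_ab_group_add tropical mat"
  assumes A: "normal_form n A"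
  shows "i < n \<Longrightarrow> j < n \<Longrightarrow> (A ^\<^sub>m k) $$ (i, j) \<le> perm_adj A $$ (i, j)"
proof (induction k arbitrary: i)
  case 0
  then show ?case
    using A one_le_perm_adj_diag[OF A, of j] by (auto simp: normal_form_def tropical_zero_le)
next
  case (Suc k)
  have carr: "A \<in> carrier_mat n n" using A by (simp add: normal_form_def)
  have "A $$ (i, l) * perm_adj A $$ (l, j) \<le> perm_adj A $$ (i, j)" if l: "l < n" for l
  proof -
    have "A $$ (i, l) * perm_adj A $$ (l, j) = (\<Sum>\<sigma> | \<sigma> permutes {0..<n} \<and> \<sigma> j = l.
        A $$ (i, l) * (\<Prod>r\<in>{0..<n} - {j}. A $$ (r, \<sigma> r)))"
      using carr l Suc.prems by (simp add: perm_adj_index sum_distrib_left)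
    also have "\<dots> \<le> perm_adj A $$ (i, j)"
      using edge_times_perm_adj_le[OF A _ Suc.prems]
      by (subst tropical_sum_le_iff[OF finite_permutations_sending]) auto
    finally show ?thesis .
  qed
  then have "A $$ (i, l) * (A ^\<^sub>m k) $$ (l, j) \<le> perm_adj A $$ (i, j)" if "l < n" for l
    using order_trans[OF tropical_mult_mono[OF order_refl Suc.IH[OF that Suc.prems(2)]]] that
    by blast
  moreover have "(A ^\<^sub>m Suc k) $$ (i, j) = (\<Sum>l = 0..<n. A $$ (i, l) * (A ^\<^sub>m k) $$ (l, j))"
    unfolding pow_mat_Suc_left[OF carr] using carr Suc.prems by (intro mult_mat_index) auto
  ultimately show ?case by (simp add: tropical_sum_le_iff)
qed

section \<open>Weights in the adjoint lie below powers of the matrix\<close>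

lemma permutation_weight_le_pow:
  fixes A :: "'g::linordered_ab_group_add tropical mat"
  assumes A: "normal_form n A" and \<sigma>: "\<sigma> permutes {0..<n}" and j: "j < n"
  shows "\<exists>k. (\<Prod>r\<in>{0..<n} - {j}. A $$ (r, \<sigma> r)) \<le> (A ^\<^sub>m k) $$ (\<sigma> j, j)"
proof -
  let ?N = "{0..<n}"
  define i where "i = \<sigma> j"
  have i: "i \<in> ?N" using permutes_in_image[OF \<sigma>, of j] j by (simp add: i_def)
  have "permutation \<sigma>" using \<sigma> by (auto simp: permutation_permutes)
  then have ex: "\<exists>m. 0 < m \<and> (\<sigma> ^^ m) i = i" by (rule permutation_self) blast
  \<comment> \<open>The length of the cycle through \<open>i\<close>; the path from \<open>i\<close>
    to \<open>j\<close> along it has \<open>k = m - 1\<close> edges.\<close>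
  define m where "m = (LEAST m. 0 < m \<and> (\<sigma> ^^ m) i = i)"
  have m: "0 < m \<and> (\<sigma> ^^ m) i = i" unfolding m_def using ex by (rule LeastI_ex)
  have "inj_on (\<lambda>t. (\<sigma> ^^ t) i) {0..<m}"
    using m not_less_Least[of _ "\<lambda>m. 0 < m \<and> (\<sigma> ^^ m) i = i"]
    by (intro inj_on_funpow_least) (auto simp: m_def)
  moreover obtain k where k: "m = Suc k" using m by (cases m) auto
  ultimately have inj: "inj_on (\<lambda>t. (\<sigma> ^^ t) i) {0..<Suc k}" by simp
  have orbit: "(\<sigma> ^^ t) i \<in> ?N" for t
    by (rule permutes_in_funpow_image[OF \<sigma> i])
  \<comment> \<open>Both points are sent to \<open>i\<close> by the injective map
    \<open>\<sigma>\<close>.\<close>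
  have last: "(\<sigma> ^^ k) i = j"
    using m k injD[OF permutes_inj[OF \<sigma>], of "(\<sigma> ^^ k) i" j] by (simp add: i_def)
  define O' where "O' = (\<lambda>t. (\<sigma> ^^ t) i) ` {0..<Suc k}"
  have sub: "O' \<subseteq> ?N" using orbit by (auto simp: O'_def)
  have "\<sigma> ((\<sigma> ^^ t) i) \<in> O'" if t: "t \<in> {0..<Suc k}" for t
  proof (cases "t = k")
    case True
    then show ?thesis
      unfolding O'_def using last by (intro image_eqI[of _ _ 0]) (auto simp: i_def)
  next
    case False
    then show ?thesis unfolding O'_def using t by (intro image_eqI[of _ _ "Suc t"]) auto
  qed
  then have "\<sigma> ` O' = O'" by (intro finite_invariantI[OF \<sigma>]) (auto simp: O'_def)
  then have compl: "\<sigma> ` (?N - O') = ?N - O'" by (rule permutes_Diff_invariant[OF \<sigma>])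
  \<comment> \<open>Leaving out time \<open>k\<close> omits exactly the edge from \<open>j\<close>
    to \<open>i\<close> that closes the cycle.\<close>
  have "(\<lambda>t. (\<sigma> ^^ t) i) ` {0..<k} = O' - {j}"
    using inj last unfolding O'_def atLeast0_lessThan_Suc by (auto simp: inj_on_insert)
  moreover have "inj_on (\<lambda>t. (\<sigma> ^^ t) i) {0..<k}" by (rule inj_on_subset[OF inj]) auto
  ultimately have path: "(\<Prod>r\<in>O' - {j}. A $$ (r, \<sigma> r)) =
      (\<Prod>t = 0..<k. A $$ ((\<sigma> ^^ t) i, (\<sigma> ^^ Suc t) i))"
    by (intro prod.reindex_cong[where l = "\<lambda>t. (\<sigma> ^^ t) i"]) auto
  have "j \<in> O'" unfolding O'_def using last by (intro image_eqI[of _ _ k]) auto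
  then have "?N - {j} = (?N - O') \<union> (O' - {j})" using sub by auto
  then have "(\<Prod>r\<in>?N - {j}. A $$ (r, \<sigma> r)) =
      (\<Prod>r\<in>?N - O'. A $$ (r, \<sigma> r)) * (\<Prod>r\<in>O' - {j}. A $$ (r, \<sigma> r))"
    using finite_subset[OF sub] by (simp only:, intro prod.union_disjoint) auto
  also have "\<dots> \<le> 1 * (\<Prod>r\<in>O' - {j}. A $$ (r, \<sigma> r))"
    by (rule tropical_mult_mono[OF invariant_weight_le_1[OF A \<sigma> _ compl] order_refl]) auto
  also have "\<dots> \<le> (A ^\<^sub>m k) $$ (\<sigma> j, j)"
    using tropical_walk_le_pow[of A n k "\<lambda>t. (\<sigma> ^^ t) i"] A orbit last
    by (simp add: path normal_form_def i_def)
  finally show ?thesis by blast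
qed

lemma isLub_UNIV_iff:
  "isLub UNIV S x \<longleftrightarrow> (\<forall>s\<in>S. s \<le> x) \<and> (\<forall>u. (\<forall>s\<in>S. s \<le> u) \<longrightarrow> x \<le> u)"
  by (simp add: isLub_def leastP_def isUb_def setle_def setge_def)

text \<open>An adjoint entry is a finite maximum of weights, each below an entry of some power, so
  it is below every upper bound of the powers. Hence the supremum exists even over an incomplete
  group.\<close>

lemma is_closure_perm_adj:
  fixes A :: "'g::linordered_ab_group_add tropical mat"
  assumes A: "normal_form n A"
  shows "is_closure n A (perm_adj A)"
  unfolding is_closure_def isLub_UNIV_iff
proof (intro conjI allI impI ballI)
  have carr: "A \<in> carrier_mat n n" using A by (simp add: normal_form_def)
  then show "perm_adj A \<in> carrier_mat n n" by simp
  fix i j assume ij: "i < n" "j < n"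
  show "s \<le> perm_adj A $$ (i, j)" if "s \<in> range (\<lambda>k. (A ^\<^sub>m k) $$ (i, j))" for s
    using that pow_le_perm_adj[OF A ij] by auto
  fix u assume u: "\<forall>s\<in>range (\<lambda>k. (A ^\<^sub>m k) $$ (i, j)). s \<le> u"
  have "(\<Prod>r\<in>{0..<n} - {j}. A $$ (r, \<sigma> r)) \<le> u" if "\<sigma> permutes {0..<n}" "\<sigma> j = i" for \<sigma>
    using permutation_weight_le_pow[OF A that(1) ij(2)] u that(2) by (auto intro: order_trans)
  then show "perm_adj A $$ (i, j) \<le> u"
    using carr ij by (simp add: perm_adj_index tropical_sum_le_iff finite_permutations_sending)
qed

subsection \<open>The supertropical case\<close>

text \<open>Adding elements of equal nu-value produces a ghost with that same nu-value, so
  \<open>nu_val\<close> forgets only tangibility and carries determinants, adjoints and powers to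
  the tropical side.\<close>

interpretation nu: comm_semiring_hom
  "nu_val :: 'g::linordered_ab_group_add supertropical \<Rightarrow> 'g tropical"
proof
  fix x y :: "'g supertropical"
  show "nu_val (x + y) = nu_val x + nu_val y"
    using linorder_less_linear[of "nu_val x" "nu_val y"]
    by (auto simp: plus_supertropical_cases plus_tropical_def nu_val_ghost_map)
  show "nu_val (x * y) = nu_val x * nu_val y" by (cases x; cases y) auto
  show "nu_val (0 :: 'g supertropical) = 0"
    by (simp add: zero_supertropical_def zero_tropical_def)
  show "nu_val (1 :: 'g supertropical) = 1"
    by (simp add: one_supertropical_def one_tropical_def)
qed

lemma nu_val_perm_adj:
  fixes B :: "'g::linordered_ab_group_add supertropical mat"
  assumes B: "B \<in> carrier_mat n n" and ij: "i < n" "j < n"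
  shows "nu_val (perm_adj B $$ (i, j)) = perm_adj (map_mat nu_val B) $$ (i, j)"
proof -
  have "nu_val (perm_adj B $$ (i, j)) =
    (\<Sum>\<sigma> | \<sigma> permutes {0..<n} \<and> \<sigma> j = i. \<Prod>r\<in>{0..<n} - {j}. nu_val (B $$ (r, \<sigma> r)))"
    using assms by (simp add: perm_adj_index nu.hom_sum nu.hom_prod)
  also have "\<dots> = (\<Sum>\<sigma> | \<sigma> permutes {0..<n} \<and> \<sigma> j = i.
      \<Prod>r\<in>{0..<n} - {j}. map_mat nu_val B $$ (r, \<sigma> r))"
  proof (intro sum.cong prod.cong refl)
    fix \<sigma> r assume "\<sigma> \<in> {\<sigma>. \<sigma> permutes {0..<n} \<and> \<sigma> j = i}" "r \<in> {0..<n} - {j}"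
    then show "nu_val (B $$ (r, \<sigma> r)) = map_mat nu_val B $$ (r, \<sigma> r)"
      using B permutes_in_image[of \<sigma> "{0..<n}" r] by auto
  qed
  finally show ?thesis using assms by (simp add: perm_adj_index)
qed

lemma normal_form_nu_val:
  fixes B :: "'g::linordered_ab_group_add supertropical mat"
  assumes B: "normal_form n B"
  shows "normal_form n (map_mat nu_val B)"
proof -
  have carr: "B \<in> carrier_mat n n" using B by (simp add: normal_form_def)
  have "perm_det (map_mat nu_val B) = nu_val (perm_det B)"
    unfolding perm_det_def nu.hom_sum nu.hom_prod
  proof (intro sum.cong prod.cong)
    fix \<sigma> r assume "\<sigma> \<in> {p. p permutes {0..<dim_row B}}" "r \<in> {0..<dim_row B}"
    then show "map_mat nu_val B $$ (r, \<sigma> r) = nu_val (B $$ (r, \<sigma> r))"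
      using carr permutes_in_image[of \<sigma> "{0..<n}" r] by auto
  qed auto
  then show ?thesis using B by (auto simp: normal_form_def)
qed

text \<open>The order compares nu-values, so an upper bound \<open>u\<close> of the powers gives the
  tropical upper bound \<open>nu_val u\<close>.\<close>

lemma is_closure_perm_adj_supertropical:
  fixes B :: "'g::linordered_ab_group_add supertropical mat"
  assumes B: "normal_form n B"
  shows "is_closure n B (perm_adj B)"
proof -
  have carr: "B \<in> carrier_mat n n" using B by (simp add: normal_form_def)
  have pow: "(map_mat nu_val B ^\<^sub>m k) $$ (i, j) = nu_val ((B ^\<^sub>m k) $$ (i, j))"
    if "i < n" "j < n" for i j k
    using that carr by (simp add: nu.mat_hom_pow[OF carr, symmetric])
  show ?thesis
    using is_closure_perm_adj[OF normal_form_nu_val[OF B]] carr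
    unfolding is_closure_def isLub_UNIV_iff less_eq_supertropical_def
    by (auto simp: pow nu_val_perm_adj[OF carr])
qed

theorem claim6p8:
  fixes n :: nat
    and A :: "'g::linordered_ab_group_add tropical mat"
    and B :: "'g::linordered_ab_group_add supertropical mat"
  shows "(normal_form n A \<longrightarrow>
            (\<exists>C. is_closure n A C) \<and> (\<forall>C. is_closure n A C \<longrightarrow> nabla A = C))
       \<and> (normal_form n B \<longrightarrow>
            (\<exists>C. is_closure n B C) \<and> (\<forall>C. is_closure n B C \<longrightarrow> mat_nu_equiv (nabla B) C))"
proof (intro conjI impI)
  assume A: "normal_form n A"
  \<comment> \<open>\<open>nabla A\<close> itself witnesses existence, and uniqueness identifies any
    other closure with it.\<close>
  then have closure: "is_closure n A (nabla A)"
    by (simp add: nabla_normal_form is_closure_perm_adj)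
  then show "\<exists>C. is_closure n A C" ..
  show "\<forall>C. is_closure n A C \<longrightarrow> nabla A = C"
    using is_closure_tropical_unique[OF closure] by blast
next
  assume B: "normal_form n B"
  then have closure: "is_closure n B (nabla B)"
    by (simp add: nabla_normal_form is_closure_perm_adj_supertropical)
  then show "\<exists>C. is_closure n B C" ..
  show "\<forall>C. is_closure n B C \<longrightarrow> mat_nu_equiv (nabla B) C"
    using is_closure_supertropical_unique[OF closure] by (auto simp: is_closure_def)
qed

end
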